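(* Let $d\ge2$, $t\ge2$, let $X=\{x_1,\ldots,x_N\}\subset\mathbb S^{d-1}$ be a spherical $t$-design with Steiner-normalized Minkowski polytope $P_X$, and suppose $\delta:=d_{\mathrm H}(P_X,B)<1$, where $B$ is the closed unit ball of $\mathbb R^d$. Let $h_i=h_{P_X}(x_i)$, $v_i=x_i/h_i$, and $$\mathcal V_m(P_X^\circ):=\frac1N\sum_{i=1}^N v_i^{\otimes m},\qquad M_{d,m}:=\int_{\mathbb S^{d-1}}u^{\otimes m}\,d\sigma(u).$$ Then for every integer $0\le m\le t$, $$\bigl\|\mathcal V_m(P_X^\circ)-M_{d,m}\bigr\|_{\mathrm{HS}}\le(1-\delta)^{-m}-1\le\exp\Bigl(\frac{m\delta}{1-\delta}\Bigr)-1.$$ Moreover, $$\frac1{1+\delta}B\subset P_X^\circ\subset\frac1{1-\delta}B,\qquad d_{\mathrm H}(P_X^\circ,B)\le\frac{\delta}{1-\delta}.$$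
   Context: $\sigma$ is the normalized (probability) surface measure on the unit sphere $\mathbb S^{d-1}\subset\mathbb R^d$, and $\omega_{d-1}$ is the total $(d-1)$-area of $\mathbb S^{d-1}$. A finite set $X=\{x_1,\ldots,x_N\}\subset\mathbb S^{d-1}$ of $N$ distinct points is a spherical $t$-design if $\frac1N\sum_i p(x_i)=\int p\,d\sigma$ for every polynomial $p$ of total degree at most $t$. For $t\ge2$, the Minkowski polytope $P_X\subset\mathbb R^d$ is the full-dimensional convex polytope, unique up to translation, whose surface area measure is $\frac{\omega_{d-1}}N\sum_i\delta_{x_i}$: it has exactly $N$ facets, with outer unit normals $x_1,\ldots,x_N$, each of $(d-1)$-area $\omega_{d-1}/N$. It is Steiner-normalized: the translate is chosen so that the Steiner point $d\int_{\mathbb S^{d-1}}h_{P_X}(u)u\,d\sigma(u)$ is $0$, which implies $0\in\operatorname{int}P_X$. Here $h_P(u)=\max_{y\in P}\langle u,y\rangle$ is the support function, $P^\circ=\{z:\langle z,y\rangle\le1\ \forall y\in P\}$ is the polar, $d_{\mathrm H}$ is Hausdorff distance, and $\|\cdot\|_{\mathrm{HS}}$ is the Hilbert--Schmidt (Euclidean) norm on tensor powers, so that $\|x^{\otimes m}\|_{\mathrm{HS}}=|x|^m$. The $v_i$ are exactly the vertices of $P_X^\circ$. *)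

theory Defs
  imports "HOL-Analysis.Analysis"
begin

section \<open>Hausdorff measure\<close>

text \<open>
  The gauge of a set is its diameter to the power \<open>k\<close>; the value \<open>\<infinity>\<close> on sets that are unbounded
  or of diameter larger than \<open>\<delta>\<close> excludes these sets from the coverings. The coverings in
  \<^const>\<open>outer_measure\<close> are disjoint, which makes no difference because the gauge is monotone.
\<close>

definition hausdorff_gauge :: "nat \<Rightarrow> real \<Rightarrow> 'a::metric_space set \<Rightarrow> ennreal" where
  "hausdorff_gauge k \<delta> S =
     (if S = {} then 0
      else if bounded S \<and> diameter S \<le> \<delta> then ennreal (diameter S ^ k) else \<infinity>)"

text \<open>
  The constant is the volume of a ball of diameter 1 in dimension \<open>k\<close>; with it, the
  \<open>k\<close>-dimensional Hausdorff measure is the \<open>k\<close>-dimensional area (for instance, it is Lebesgue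
  measure in a \<open>k\<close>-dimensional affine subspace).
\<close>

definition hausdorff_outer :: "nat \<Rightarrow> 'a::metric_space set \<Rightarrow> ennreal" where
  "hausdorff_outer k A =
     ennreal (unit_ball_vol (real k) / 2 ^ k) *
     (SUP \<delta>\<in>{0<..}. outer_measure (Pow UNIV) (hausdorff_gauge k \<delta>) A)"

definition hausdorff_measure :: "nat \<Rightarrow> 'a::metric_space measure" where
  "hausdorff_measure k = measure_of UNIV (sets borel) (hausdorff_outer k)"

lemma hausdorff_gauge_empty [simp]: "hausdorff_gauge k \<delta> {} = 0"
  by (simp add: hausdorff_gauge_def)

lemma hausdorff_gauge_mono:
  assumes "S \<subseteq> T" shows "hausdorff_gauge k \<delta> S \<le> hausdorff_gauge k \<delta> T"
proof (cases "S = {} \<or> \<not> (bounded T \<and> diameter T \<le> \<delta>)")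
  case True
  then show ?thesis using assms by (auto simp: hausdorff_gauge_def)
next
  case False
  then have "bounded S" "diameter S \<le> diameter T" "0 \<le> diameter S"
    using assms bounded_subset diameter_subset diameter_ge_0 by blast+
  then show ?thesis
    using False assms by (auto simp: hausdorff_gauge_def intro!: ennreal_leI power_mono)
qed

lemma hausdorff_gauge_antimono:
  assumes "\<delta> \<le> \<epsilon>" shows "hausdorff_gauge k \<epsilon> S \<le> hausdorff_gauge k \<delta> S"
  using assms by (auto simp: hausdorff_gauge_def)

lemma outer_measure_space_gauge:
  "outer_measure_space (Pow UNIV) (outer_measure (Pow UNIV) (hausdorff_gauge k \<delta>))"
proof -
  interpret sigma_algebra UNIV "Pow UNIV :: 'a set set"
    by (rule sigma_algebra_Pow)
  show ?thesis
    by (rule outer_measure_space_outer_measure)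
       (auto simp: positive_def increasing_def hausdorff_gauge_mono)
qed

lemma outer_measure_gauge_antimono:
  assumes "\<delta> \<le> \<epsilon>"
  shows "outer_measure (Pow UNIV) (hausdorff_gauge k \<epsilon>) A
       \<le> outer_measure (Pow UNIV) (hausdorff_gauge k \<delta>) A"
  unfolding outer_measure_def
  by (intro INF_mono') (auto intro!: suminf_le hausdorff_gauge_antimono[OF assms])

lemma outer_measure_space_hausdorff:
  "outer_measure_space (Pow UNIV) (hausdorff_outer k :: 'a::metric_space set \<Rightarrow> ennreal)"
proof -
  let ?O = "\<lambda>\<delta>. outer_measure (Pow UNIV) (hausdorff_gauge k \<delta>) :: 'a set \<Rightarrow> ennreal"
  have pos: "?O \<delta> {} = 0" and mono: "A \<subseteq> B \<Longrightarrow> ?O \<delta> A \<le> ?O \<delta> B" for \<delta> A B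
    using outer_measure_space_gauge[of k \<delta>]
    by (auto simp: outer_measure_space_def positive_def increasing_def)
  have sub: "?O \<delta> (\<Union>i. A i) \<le> (\<Sum>i. ?O \<delta> (A i))" if "disjoint_family A" for \<delta> and A :: "nat \<Rightarrow> 'a set"
    using outer_measure_space_gauge[of k \<delta>] that
    by (auto simp: outer_measure_space_def countably_subadditive_def)
  have "hausdorff_outer k (\<Union>i. A i) \<le> (\<Sum>i. hausdorff_outer k (A i))"
    if "disjoint_family A" for A :: "nat \<Rightarrow> 'a set"
  proof -
    have "(SUP \<delta>\<in>{0<..}. ?O \<delta> (\<Union>i. A i)) \<le> (\<Sum>i. SUP \<delta>\<in>{0<..}. ?O \<delta> (A i))"
    proof (rule SUP_least)
      fix \<delta> :: real assume "\<delta> \<in> {0<..}"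
      have "?O \<delta> (\<Union>i. A i) \<le> (\<Sum>i. ?O \<delta> (A i))" by (rule sub[OF that])
      also have "\<dots> \<le> (\<Sum>i. SUP \<delta>\<in>{0<..}. ?O \<delta> (A i))"
        by (intro suminf_le SUP_upper \<open>\<delta> \<in> {0<..}\<close>) auto
      finally show "?O \<delta> (\<Union>i. A i) \<le> (\<Sum>i. SUP \<delta>\<in>{0<..}. ?O \<delta> (A i))" .
    qed
    then show ?thesis
      by (auto simp: hausdorff_outer_def intro: mult_left_mono)
  qed
  moreover have "hausdorff_outer k ({} :: 'a set) = 0"
    by (simp add: hausdorff_outer_def pos del: Pow_UNIV)
  moreover have "hausdorff_outer k A \<le> hausdorff_outer k B" if "A \<subseteq> B" for A B :: "'a set"
    unfolding hausdorff_outer_def by (intro mult_left_mono SUP_mono' mono[OF that]) simp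
  ultimately show ?thesis
    by (auto simp: outer_measure_space_def positive_def increasing_def countably_subadditive_def)
qed

lemma hausdorff_outer_mono: "A \<subseteq> B \<Longrightarrow> hausdorff_outer k A \<le> hausdorff_outer k B"
  using outer_measure_space_hausdorff[of k]
  by (auto simp: outer_measure_space_def increasing_def)

lemma hausdorff_outer_empty [simp]: "hausdorff_outer k {} = 0"
  using outer_measure_space_hausdorff[of k]
  by (auto simp: outer_measure_space_def positive_def)

lemma hausdorff_outer_UN:
  fixes A :: "nat \<Rightarrow> 'a::metric_space set"
  shows "hausdorff_outer k (\<Union>i. A i) \<le> (\<Sum>i. hausdorff_outer k (A i))"
proof -
  have "hausdorff_outer k (\<Union>i. disjointed A i) \<le> (\<Sum>i. hausdorff_outer k (disjointed A i))"
    using outer_measure_space_hausdorff[of k] disjoint_family_disjointed[of A]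
    by (auto simp: outer_measure_space_def countably_subadditive_def)
  also have "\<dots> \<le> (\<Sum>i. hausdorff_outer k (A i))"
    by (intro suminf_le hausdorff_outer_mono) (auto simp: disjointed_def)
  finally show ?thesis by (simp add: UN_disjointed_eq)
qed

lemma hausdorff_outer_Un:
  "hausdorff_outer k (A \<union> B) \<le> hausdorff_outer k A + hausdorff_outer k B"
proof -
  have "subadditive (Pow UNIV) (hausdorff_outer k :: 'a set \<Rightarrow> ennreal)"
  proof -
    interpret sigma_algebra UNIV "Pow UNIV :: 'a set set"
      by (rule sigma_algebra_Pow)
    show ?thesis
      using outer_measure_space_hausdorff[of k]
      by (intro countably_subadditive_subadditive) (auto simp: outer_measure_space_def)
  qed
  then have disj: "hausdorff_outer k (A \<union> (B - A)) \<le> hausdorff_outer k A + hausdorff_outer k (B - A)"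
    unfolding subadditive_def by (metis Diff_disjoint PowI top_greatest)
  have "A \<union> (B - A) = A \<union> B" by auto
  with disj show ?thesis
    by (metis Diff_subset add_left_mono hausdorff_outer_mono order_trans)
qed

lemma hausdorff_outer_separated:
  fixes A B :: "'a::metric_space set"
  assumes "e > 0" and sep: "\<And>x y. x \<in> A \<Longrightarrow> y \<in> B \<Longrightarrow> e \<le> dist x y"
  shows "hausdorff_outer k A + hausdorff_outer k B \<le> hausdorff_outer k (A \<union> B)"
proof -
  let ?O = "\<lambda>\<delta>. outer_measure (Pow UNIV) (hausdorff_gauge k \<delta>) :: 'a set \<Rightarrow> ennreal"
  let ?S = "\<lambda>A. SUP \<delta>\<in>{0<..}. ?O \<delta> A"
  have small: "?O \<delta> A + ?O \<delta> B \<le> ?O \<delta> (A \<union> B)" if "\<delta> < e" for \<delta>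
    unfolding outer_measure_def[of _ _ "A \<union> B"]
  proof (safe intro!: INF_greatest)
    fix C :: "nat \<Rightarrow> 'a set"
    assume C: "disjoint_family C" "A \<union> B \<subseteq> (\<Union>i. C i)"
    have le: "?O \<delta> T \<le> (\<Sum>i. hausdorff_gauge k \<delta> (C i \<inter> T))" if "T \<subseteq> (\<Union>i. C i)" for T
      unfolding outer_measure_def
      using C(1) that by (intro INF_lower) (auto simp: disjoint_family_on_def)
    have split: "hausdorff_gauge k \<delta> (C i \<inter> A) + hausdorff_gauge k \<delta> (C i \<inter> B)
               \<le> hausdorff_gauge k \<delta> (C i)" for i
    proof (cases "C i \<inter> A = {} \<or> C i \<inter> B = {} \<or> \<not> (bounded (C i) \<and> diameter (C i) \<le> \<delta>)")
      case True
      moreover have "hausdorff_gauge k \<delta> (C i) = \<infinity>"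
        if "\<not> (bounded (C i) \<and> diameter (C i) \<le> \<delta>)" "C i \<noteq> {}"
        using that by (simp add: hausdorff_gauge_def)
      ultimately show ?thesis
        using hausdorff_gauge_mono[of "C i \<inter> A" "C i" k \<delta>]
              hausdorff_gauge_mono[of "C i \<inter> B" "C i" k \<delta>] by fastforce
    next
      case False
      then obtain x y where "x \<in> C i" "x \<in> A" "y \<in> C i" "y \<in> B" by blast
      moreover from this have "dist x y \<le> \<delta>"
        using False diameter_bounded_bound[of "C i" x y] by simp
      ultimately show ?thesis using sep[of x y] that by auto
    qed
    have "?O \<delta> A + ?O \<delta> B
        \<le> (\<Sum>i. hausdorff_gauge k \<delta> (C i \<inter> A)) + (\<Sum>i. hausdorff_gauge k \<delta> (C i \<inter> B))"
      using C(2) by (intro add_mono le) auto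
    also have "\<dots> = (\<Sum>i. hausdorff_gauge k \<delta> (C i \<inter> A) + hausdorff_gauge k \<delta> (C i \<inter> B))"
      by (rule suminf_add) auto
    also have "\<dots> \<le> (\<Sum>i. hausdorff_gauge k \<delta> (C i))"
      by (intro suminf_le split) auto
    finally show "?O \<delta> A + ?O \<delta> B \<le> (\<Sum>i. hausdorff_gauge k \<delta> (C i))" .
  qed
  have pair: "?O \<delta> A + ?O \<epsilon> B \<le> ?S (A \<union> B)" if "\<delta> > 0" "\<epsilon> > 0" for \<delta> \<epsilon>
  proof -
    define \<mu> where "\<mu> = min (min \<delta> \<epsilon>) (e / 2)"
    have \<mu>: "0 < \<mu>" "\<mu> < e" "\<mu> \<le> \<delta>" "\<mu> \<le> \<epsilon>"
      using that \<open>e > 0\<close> by (auto simp: \<mu>_def min_def)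
    have "?O \<delta> A + ?O \<epsilon> B \<le> ?O \<mu> A + ?O \<mu> B"
      by (intro add_mono outer_measure_gauge_antimono \<mu>)
    also have "\<dots> \<le> ?O \<mu> (A \<union> B)" by (rule small[OF \<mu>(2)])
    also have "\<dots> \<le> ?S (A \<union> B)" using \<mu>(1) by (intro SUP_upper) auto
    finally show ?thesis .
  qed
  have "?S A + ?S B \<le> ?S (A \<union> B)"
  proof -
    have "?S A + ?O \<epsilon> B \<le> ?S (A \<union> B)" if "\<epsilon> > 0" for \<epsilon>
    proof -
      have "?S A + ?O \<epsilon> B = (SUP \<delta>\<in>{0<..}. ?O \<delta> A + ?O \<epsilon> B)"
        by (subst ennreal_SUP_add_left) (auto simp: add.commute)
      also have "\<dots> \<le> ?S (A \<union> B)" using pair that by (intro SUP_least) auto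
      finally show ?thesis .
    qed
    moreover have "?S A + ?S B = (SUP \<epsilon>\<in>{0<..}. ?S A + ?O \<epsilon> B)"
      by (subst ennreal_SUP_add_right) auto
    ultimately show ?thesis by (auto intro!: SUP_least)
  qed
  then show ?thesis
    by (simp add: hausdorff_outer_def mult_left_mono flip: distrib_left)
qed

lemma closed_hausdorff_measurable:
  fixes L :: "'a::metric_space set"
  assumes "closed L"
  shows "hausdorff_outer k (E \<inter> L) + hausdorff_outer k (E - L) = hausdorff_outer k E"
proof (cases "L = {} \<or> hausdorff_outer k E = \<infinity>")
  case True
  then show ?thesis
    using hausdorff_outer_Un[of k "E \<inter> L" "E - L"]
    by (auto simp: Int_Diff_Un top_unique)
next
  case False
  let ?f = "hausdorff_outer k :: 'a set \<Rightarrow> ennreal"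
  define A where "A n = {y \<in> E. 1 / Suc n \<le> infdist y L}" for n
  define R where "R n = A (Suc n) - A n" for n
  have fin: "?f E \<noteq> \<infinity>" and ne: "L \<noteq> {}" using False by auto
  have far: "\<bar>infdist x L - infdist y L\<bar> \<le> dist x y" for x y
    using infdist_triangle[of x L y] infdist_triangle[of y L x] by (auto simp: dist_commute)
  have odd_even: "(\<Sum>j. ?f (R (2 * j + p))) \<le> ?f E" for p
  proof (rule suminf_le_const)
    fix n
    have "(\<Sum>j<n. ?f (R (2 * j + p))) \<le> ?f (\<Union>j<n. R (2 * j + p))"
    proof (induction n)
      case (Suc n)
      have gap: "1 / real (2 * n + p) - 1 / real (2 * n + p + 1) \<le> dist x y"
        if x: "x \<in> (\<Union>j<n. R (2 * j + p))" and y: "y \<in> R (2 * n + p)" for x y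
      proof -
        obtain j where j: "j < n" "x \<in> R (2 * j + p)" using x by blast
        then have "1 / real (2 * j + p + 2) \<le> infdist x L"
          by (auto simp: R_def A_def algebra_simps)
        moreover have "1 / real (2 * n + p) \<le> 1 / real (2 * j + p + 2)"
          using j by (intro divide_left_mono) auto
        moreover have "infdist y L \<le> 1 / real (2 * n + p + 1)"
          using y by (auto simp: R_def A_def algebra_simps)
        ultimately show ?thesis using far[of x y] by linarith
      qed
      show ?case
      proof (cases "n = 0")
        case False
        have "1 / real (2 * n + p + 1) < 1 / real (2 * n + p)"
          using False by (intro divide_strict_left_mono) auto
        then have "?f (\<Union>j<n. R (2 * j + p)) + ?f (R (2 * n + p))
            \<le> ?f ((\<Union>j<n. R (2 * j + p)) \<union> R (2 * n + p))"
          by (intro hausdorff_outer_separated[where e="1 / real (2 * n + p) - 1 / real (2 * n + p + 1)"] gap)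
             auto
        also have "(\<Union>j<n. R (2 * j + p)) \<union> R (2 * n + p) = (\<Union>j<Suc n. R (2 * j + p))"
          by (auto simp: less_Suc_eq)
        finally show ?thesis using Suc by (auto intro: order_trans add_mono)
      qed (simp add: lessThan_Suc)
    qed simp
    also have "\<dots> \<le> ?f E" by (intro hausdorff_outer_mono) (auto simp: R_def A_def)
    finally show "(\<Sum>j<n. ?f (R (2 * j + p))) \<le> ?f E" .
  qed auto
  have summ: "(\<Sum>j. ?f (R (2 * j + p))) < \<infinity>" for p
    using odd_even[of p] fin by (simp add: less_top top_unique order_le_less_trans)
  have near: "?f (E \<inter> L) + ?f (A n) \<le> ?f E" for n
  proof -
    have "?f (E \<inter> L) + ?f (A n) \<le> ?f (E \<inter> L \<union> A n)"
    proof (rule hausdorff_outer_separated[where e="1 / Suc n"])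
      fix x y assume "x \<in> E \<inter> L" "y \<in> A n"
      then show "1 / Suc n \<le> dist x y"
        using infdist_le[of x L y] by (auto simp: A_def dist_commute)
    qed simp
    also have "\<dots> \<le> ?f E" by (intro hausdorff_outer_mono) (auto simp: A_def)
    finally show ?thesis .
  qed
  have A_mono: "A m \<subseteq> A n" if "m \<le> n" for m n
  proof -
    have "1 / real (Suc n) \<le> 1 / real (Suc m)" using that by (intro divide_left_mono) auto
    then show ?thesis by (auto simp: A_def)
  qed
  have cover: "E - L \<subseteq> A (2 * n) \<union> ((\<Union>j. R (2 * (j + n) + 0)) \<union> (\<Union>j. R (2 * (j + n) + 1)))" for n
  proof
    fix x assume x: "x \<in> E - L"
    then have "infdist x L > 0"
      using assms ne by (metis DiffD2 in_closed_iff_infdist_zero infdist_nonneg less_le)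
    then obtain m where "1 / real (Suc m) < infdist x L"
      using reals_Archimedean by (auto simp: inverse_eq_divide)
    then have ex: "\<exists>m. x \<in> A m" using x by (auto simp: A_def intro!: exI[of _ m])
    define m where "m = (LEAST m. x \<in> A m)"
    have m: "x \<in> A m" "\<And>i. i < m \<Longrightarrow> x \<notin> A i"
      using LeastI_ex[OF ex] not_less_Least by (auto simp: m_def)
    show "x \<in> A (2 * n) \<union> ((\<Union>j. R (2 * (j + n) + 0)) \<union> (\<Union>j. R (2 * (j + n) + 1)))"
    proof (cases "m \<le> 2 * n")
      case True
      then show ?thesis using m A_mono by blast
    next
      case False
      define i where "i = m - 1"
      have "x \<in> R i" "2 * n \<le> i" using m False by (auto simp: R_def i_def)
      moreover have "i = 2 * ((i div 2 - n) + n) + i mod 2" using \<open>2 * n \<le> i\<close> by auto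
      moreover have "i mod 2 = 0 \<or> i mod 2 = 1" by auto
      ultimately show ?thesis by (metis UN_I UNIV_I UnI1 UnI2)
    qed
  qed
  let ?T = "\<lambda>n p. \<Sum>j. ?f (R (2 * (j + n) + p))"
  have bound: "?f (E \<inter> L) + ?f (E - L) \<le> ?f E + (?T n 0 + ?T n 1)" for n
  proof -
    have "?f (E - L) \<le> ?f (A (2 * n)) + (?T n 0 + ?T n 1)"
      by (intro order_trans[OF hausdorff_outer_mono[OF cover[of n]]]
                order_trans[OF hausdorff_outer_Un] add_mono order_refl
                hausdorff_outer_UN)
    then have "?f (E \<inter> L) + ?f (E - L) \<le> (?f (E \<inter> L) + ?f (A (2 * n))) + (?T n 0 + ?T n 1)"
      by (simp add: add.assoc add_left_mono)
    also have "\<dots> \<le> ?f E + (?T n 0 + ?T n 1)" by (intro add_right_mono near)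
    finally show ?thesis .
  qed
  have tail: "(\<lambda>n. ?T n p) \<longlonglongrightarrow> 0" for p
  proof -
    define g where "g j = enn2real (?f (R (2 * j + p)))" for j
    have g: "?f (R (2 * j + p)) = ennreal (g j)" for j
    proof -
      have "?f (R (2 * j + p)) \<le> ?f E" by (intro hausdorff_outer_mono) (auto simp: R_def A_def)
      then show ?thesis using fin by (auto simp: g_def top_unique less_top)
    qed
    have g0: "g j \<ge> 0" for j by (simp add: g_def)
    have sg: "summable g"
      using summ[of p] g g0 by (intro summable_suminf_not_top) auto
    have "?T n p = ennreal (\<Sum>j. g (j + n))" for n
      unfolding g using g0 sg by (simp add: suminf_ennreal2 summable_iff_shift)
    moreover have "(\<lambda>n. \<Sum>j. g (j + n)) \<longlonglongrightarrow> 0" by (rule suminf_exist_split2[OF sg])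
    ultimately show ?thesis using tendsto_ennrealI by fastforce
  qed
  have "(\<lambda>n. ?f E + (?T n 0 + ?T n 1)) \<longlonglongrightarrow> ?f E + (0 + 0)"
    by (intro tendsto_add tail tendsto_const)
  then have "?f (E \<inter> L) + ?f (E - L) \<le> ?f E"
    using bound by (intro LIMSEQ_le_const) auto
  then show ?thesis
    using hausdorff_outer_Un[of k "E \<inter> L" "E - L"] by (auto simp: Int_Diff_Un intro: antisym)
qed

lemma space_hausdorff_measure [simp]: "space (hausdorff_measure k) = UNIV"
  by (simp add: hausdorff_measure_def)

lemma sets_hausdorff_measure [simp, measurable_cong]: "sets (hausdorff_measure k) = sets borel"
  unfolding hausdorff_measure_def
  by (metis sets.sets_measure_of_eq space_borel)

lemma emeasure_hausdorff_measure:
  fixes A :: "'a::metric_space set"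
  assumes "A \<in> sets borel"
  shows "emeasure (hausdorff_measure k) A = hausdorff_outer k A"
proof -
  interpret P: sigma_algebra UNIV "Pow UNIV :: 'a set set" by (rule sigma_algebra_Pow)
  let ?L = "lambda_system UNIV (Pow UNIV) (hausdorff_outer k :: 'a set \<Rightarrow> ennreal)"
  have ms: "measure_space UNIV ?L (hausdorff_outer k)"
    by (rule P.caratheodory_lemma[OF outer_measure_space_hausdorff])
  then interpret L: sigma_algebra UNIV ?L by (simp add: measure_space_def)
  have "sigma_sets UNIV (Collect closed) \<subseteq> ?L"
    by (rule L.sigma_sets_subset)
       (auto simp: P.lambda_system_eq closed_hausdorff_measurable simp del: Pow_UNIV)
  then have sub: "sets (borel :: 'a measure) \<subseteq> ?L"
    by (simp add: borel_eq_closed)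
  show ?thesis
    unfolding hausdorff_measure_def
  proof (rule emeasure_measure_of_sigma)
    show "sigma_algebra UNIV (sets (borel :: 'a measure))"
      by (metis sets.sigma_algebra_axioms space_borel)
    show "positive (sets (borel :: 'a measure)) (hausdorff_outer k)"
      by (simp add: positive_def)
    show "countably_additive (sets (borel :: 'a measure)) (hausdorff_outer k)"
      using ms sub unfolding measure_space_def countably_additive_def by (meson order_trans L.countable_UN subset_iff)
  qed (rule assms)
qed

section \<open>The sphere and spherical designs\<close>

text \<open>Normalized surface measure on the unit sphere (a measure on the whole space, supported there).\<close>

definition sphere_measure :: "(real ^ 'n) measure" where
  "sphere_measure = uniform_measure (hausdorff_measure (CARD('n) - 1)) (sphere 0 1)"

definition sphere_area :: "'n::finite itself \<Rightarrow> ennreal" where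
  "sphere_area _ = emeasure (hausdorff_measure (CARD('n) - 1)) (sphere (0 :: real ^ 'n) 1)"

definition polynomial_of_degree_le :: "nat \<Rightarrow> (real ^ 'n \<Rightarrow> real) \<Rightarrow> bool" where
  "polynomial_of_degree_le t p \<longleftrightarrow>
     (\<exists>c :: ('n \<Rightarrow> nat) \<Rightarrow> real.
        \<forall>x. p x = (\<Sum>\<alpha> | sum \<alpha> UNIV \<le> t. c \<alpha> * (\<Prod>i\<in>UNIV. (x $ i) ^ \<alpha> i)))"

lemma finite_multi_indices: "finite {\<alpha> :: 'n::finite \<Rightarrow> nat. sum \<alpha> UNIV \<le> t}"
proof (rule finite_subset)
  have "\<alpha> i \<le> t" if "sum \<alpha> UNIV \<le> t" for \<alpha> :: "'n \<Rightarrow> nat" and i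
    using member_le_sum[of i UNIV \<alpha>] that by simp
  then show "{\<alpha> :: 'n \<Rightarrow> nat. sum \<alpha> UNIV \<le> t} \<subseteq> PiE UNIV (\<lambda>_. {..t})"
    by (auto simp: PiE_UNIV_domain)
qed (simp add: finite_PiE)

definition spherical_design :: "nat \<Rightarrow> (real ^ 'n) set \<Rightarrow> bool" where
  "spherical_design t X \<longleftrightarrow>
     finite X \<and> X \<noteq> {} \<and> X \<subseteq> sphere 0 1 \<and>
     (\<forall>p. polynomial_of_degree_le t p \<longrightarrow>
        (\<Sum>x\<in>X. p x) / real (card X) = (\<integral>u. p u \<partial>sphere_measure))"

section \<open>Convex bodies\<close>

definition support_function :: "'a::real_inner set \<Rightarrow> 'a \<Rightarrow> real" where
  "support_function P u = (SUP y\<in>P. u \<bullet> y)"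

definition polar :: "'a::real_inner set \<Rightarrow> 'a set" where
  "polar P = {z. \<forall>y\<in>P. z \<bullet> y \<le> 1}"

definition steiner_point :: "(real ^ 'n) set \<Rightarrow> real ^ 'n" where
  "steiner_point P = real CARD('n) *\<^sub>R (\<integral>u. support_function P u *\<^sub>R u \<partial>sphere_measure)"

text \<open>Meaningful for nonempty bounded sets only, as the suprema are taken in the reals.\<close>

definition hausdorff_dist :: "'a::metric_space set \<Rightarrow> 'a set \<Rightarrow> real" where
  "hausdorff_dist A B = max (SUP a\<in>A. infdist a B) (SUP b\<in>B. infdist b A)"

text \<open>Boundary points at which some vector in \<open>U\<close> is an outer unit normal.\<close>

definition reverse_spherical_image :: "'a::real_inner set \<Rightarrow> 'a set \<Rightarrow> 'a set" where
  "reverse_spherical_image P U =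
     {y \<in> frontier P. \<exists>u\<in>U. norm u = 1 \<and> u \<bullet> y = support_function P u}"

definition surface_area :: "(real ^ 'n) set \<Rightarrow> (real ^ 'n) set \<Rightarrow> ennreal" where
  "surface_area P U = emeasure (hausdorff_measure (CARD('n) - 1)) (reverse_spherical_image P U)"

text \<open>
  The surface area measure of \<open>P\<close> is the sum of the point masses \<open>\<omega> / N\<close> at the points of \<open>X\<close>,
  where \<open>\<omega>\<close> is the area of the unit sphere and \<open>N = card X\<close>. By Minkowski's theorem this
  determines \<open>P\<close> up to translation.
\<close>

definition is_minkowski_polytope :: "(real ^ 'n) set \<Rightarrow> (real ^ 'n) set \<Rightarrow> bool" where
  "is_minkowski_polytope X P \<longleftrightarrow>
     polytope P \<and> interior P \<noteq> {} \<and>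
     (\<forall>U\<in>sets borel. U \<subseteq> sphere 0 1 \<longrightarrow>
        surface_area P U
          = sphere_area TYPE('n) / of_nat (card X) * of_nat (card (X \<inter> U)))"

section \<open>Tensors\<close>

text \<open>
  A tensor of order \<open>m\<close> is given by its components with respect to the standard basis, which are
  indexed by the lists of length \<open>m\<close> over the index type; values on other lists are irrelevant.
\<close>

type_synonym 'n tensor = "'n list \<Rightarrow> real"

definition tensor_power :: "nat \<Rightarrow> real ^ 'n \<Rightarrow> 'n tensor" where
  "tensor_power m x = (\<lambda>I. \<Prod>k<m. x $ (I ! k))"

definition hs_norm :: "nat \<Rightarrow> 'n::finite tensor \<Rightarrow> real" where
  "hs_norm m T = sqrt (\<Sum>I | length I = m. (T I)\<^sup>2)"

lemma hs_norm_tensor_power: "hs_norm m (tensor_power m x) = norm x ^ m"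
proof -
  have "(\<Sum>I | length I = m. (tensor_power m x I)\<^sup>2) = (norm x ^ m)\<^sup>2"
  proof (induction m)
    case (Suc m)
    have lists: "{I :: 'n list. length I = Suc m} = (\<lambda>(i, I). i # I) ` (UNIV \<times> {I. length I = m})"
      by (auto simp: length_Suc_conv image_iff)
    have "(\<Sum>I | length I = Suc m. (tensor_power (Suc m) x I)\<^sup>2)
        = (\<Sum>(i, I)\<in>UNIV \<times> {I. length I = m}. (x $ i)\<^sup>2 * (tensor_power m x I)\<^sup>2)"
      unfolding lists tensor_power_def
      by (subst sum.reindex)
         (auto simp: inj_on_def prod.lessThan_Suc_shift power_mult_distrib
               intro!: sum.cong simp del: prod.lessThan_Suc)
    also have "\<dots> = (\<Sum>i\<in>UNIV. (x $ i)\<^sup>2) * (norm x ^ m)\<^sup>2"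
      by (simp add: sum.cartesian_product[symmetric] sum_product[symmetric] Suc)
    also have "(\<Sum>i\<in>UNIV. (x $ i)\<^sup>2) = (norm x)\<^sup>2"
      by (simp add: norm_vec_def L2_set_def sum_nonneg)
    finally show ?case by (simp add: power_mult_distrib)
  qed (simp add: tensor_power_def)
  then show ?thesis by (simp add: hs_norm_def)
qed

text \<open>\<open>v\<^sub>i = x\<^sub>i / h\<^sub>i\<close>, the vertices of the polar of \<open>P\<close> when \<open>P\<close> is the Minkowski polytope of \<open>X\<close>.\<close>

definition dual_vertex :: "(real ^ 'n) set \<Rightarrow> real ^ 'n \<Rightarrow> real ^ 'n" where
  "dual_vertex P x = x /\<^sub>R support_function P x"

definition vertex_moment :: "nat \<Rightarrow> (real ^ 'n) set \<Rightarrow> (real ^ 'n) set \<Rightarrow> 'n tensor" where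
  "vertex_moment m X P =
     (\<lambda>I. (\<Sum>x\<in>X. tensor_power m (dual_vertex P x) I) / real (card X))"

definition sphere_moment :: "nat \<Rightarrow> 'n::finite tensor" where
  "sphere_moment m = (\<lambda>I. \<integral>u. tensor_power m u I \<partial>sphere_measure)"

end

theory Submission
  imports Defs
begin

text \<open>
  A convex body at Hausdorff distance \<open>\<delta> < 1\<close> from the unit ball lies between the balls of radius
  \<open>1 - \<delta>\<close> and \<open>1 + \<delta>\<close>, which bounds its support function and, by duality, its polar. As the components
  of \<open>u\<^sup>\<otimes>\<^sup>m\<close> are polynomials of degree \<open>m \<le> t\<close>, the design property turns the moment difference
  into the average of \<open>(h\<^sub>i\<^sup>-\<^sup>m - 1) x\<^sub>i\<^sup>\<otimes>\<^sup>m\<close>, where \<open>h\<^sub>i\<^sup>-\<^sup>1\<close> lies between \<open>1 - \<delta>\<close> and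
  \<open>(1 - \<delta>)\<^sup>-\<^sup>1\<close>.
\<close>

section \<open>Hausdorff distance of bounded and compact sets\<close>

lemma bdd_above_infdist:
  assumes "bounded A" "b \<in> B"
  shows "bdd_above ((\<lambda>a. infdist a B) ` A)"
proof -
  obtain e where "\<And>a. a \<in> A \<Longrightarrow> dist b a \<le> e"
    using assms(1) bounded_any_center[of A b] by blast
  then show ?thesis
    using infdist_le[OF assms(2)] by (intro bdd_aboveI2[where M=e]) (metis dist_commute order_trans)
qed

lemma infdist_le_hausdorff_dist:
  assumes "bounded A" "bounded B"
  shows "a \<in> A \<Longrightarrow> B \<noteq> {} \<Longrightarrow> infdist a B \<le> hausdorff_dist A B"
    and "b \<in> B \<Longrightarrow> A \<noteq> {} \<Longrightarrow> infdist b A \<le> hausdorff_dist A B"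
  unfolding hausdorff_dist_def
  using cSUP_upper[OF _ bdd_above_infdist[OF assms(1)], of a]
    cSUP_upper[OF _ bdd_above_infdist[OF assms(2)], of b]
  by (auto intro: max.coboundedI1 max.coboundedI2)

text \<open>In a closed nonempty set \<open>infdist\<close> is attained, so the bound on it yields
  an actual nearby point.\<close>

lemma ex_near_hausdorff_dist:
  fixes A B :: "'a::heine_borel set"
  assumes "compact A" "compact B" "A \<noteq> {}" "B \<noteq> {}"
  shows "a \<in> A \<Longrightarrow> \<exists>b\<in>B. dist a b \<le> hausdorff_dist A B"
    and "b \<in> B \<Longrightarrow> \<exists>a\<in>A. dist a b \<le> hausdorff_dist A B"
proof -
  have bdd: "bounded A" "bounded B" and cl: "closed A" "closed B"
    using assms by (auto simp: compact_imp_bounded compact_imp_closed)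
  show "\<exists>b\<in>B. dist a b \<le> hausdorff_dist A B" if "a \<in> A"
    using infdist_attains_inf[OF cl(2) assms(4), of a]
      infdist_le_hausdorff_dist(1)[OF bdd that assms(4)] by metis
  show "\<exists>a\<in>A. dist a b \<le> hausdorff_dist A B" if "b \<in> B"
    using infdist_attains_inf[OF cl(1) assms(3), of b]
      infdist_le_hausdorff_dist(2)[OF bdd that assms(3)] by (metis dist_commute)
qed

lemma hausdorff_dist_nonneg:
  assumes "bounded A" "bounded B" "A \<noteq> {}" "B \<noteq> {}"
  shows "0 \<le> hausdorff_dist A B"
proof -
  obtain a where "a \<in> A" using assms by blast
  then show ?thesis
    using infdist_le_hausdorff_dist(1)[OF assms(1,2) _ assms(4)] infdist_nonneg
    by (meson order_trans)
qed

section \<open>Convex bodies close to the unit ball\<close>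

lemma hausdorff_dist_unit_ball_norm_le:
  fixes P :: "'a::euclidean_space set"
  assumes "compact P" "y \<in> P"
  shows "norm y \<le> 1 + hausdorff_dist P (cball 0 1)"
proof -
  obtain b where b: "norm b \<le> 1" "dist y b \<le> hausdorff_dist P (cball 0 1)"
    using ex_near_hausdorff_dist(1)[of P "cball 0 1" y] assms by fastforce
  have "norm y \<le> dist y b + norm b"
    using norm_triangle_sub[of y b] by (simp add: dist_norm add.commute)
  then show ?thesis using b by linarith
qed

text \<open>A point \<open>z\<close> outside \<open>P\<close> is cut off by a hyperplane with unit
  normal \<open>u\<close>. Some \<open>p\<close> in \<open>P\<close> lies within the Hausdorff
  distance \<delta> of \<open>u\<close>, so \<open>u \<bullet> p\<close> is at least 1 - \<delta>,
  which is at least \<open>u \<bullet> z\<close>; this contradicts the separation.\<close>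

lemma cball_subset_hausdorff_dist_unit_ball:
  fixes P :: "'a::euclidean_space set"
  assumes "compact P" "convex P" "P \<noteq> {}"
  shows "cball 0 (1 - hausdorff_dist P (cball 0 1)) \<subseteq> P"
proof (rule subsetI, rule ccontr)
  let ?\<delta> = "hausdorff_dist P (cball 0 1)"
  fix z assume z: "z \<in> cball 0 (1 - ?\<delta>)" "z \<notin> P"
  obtain a b where ab: "a \<bullet> z < b" "\<forall>x\<in>P. b < a \<bullet> x"
    using separating_hyperplane_closed_point[OF assms(2) compact_imp_closed[OF assms(1)] z(2)]
    by blast
  have "a \<noteq> 0" using ab assms(3) by auto
  \<comment> \<open>The functional \<open>a\<close> is larger on \<open>P\<close> than at
    \<open>z\<close>, so the sign makes \<open>u\<close> point from \<open>P\<close> towards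
    \<open>z\<close>.\<close>
  define u where "u = - sgn a"
  have u: "norm u = 1" by (simp add: u_def norm_sgn \<open>a \<noteq> 0\<close>)
  obtain p where p: "p \<in> P" "dist p u \<le> ?\<delta>"
    using ex_near_hausdorff_dist(2)[of P "cball 0 1" u] assms u by auto
  have "a \<bullet> z < a \<bullet> p" using ab p(1) by fastforce
  then have "u \<bullet> p < u \<bullet> z"
    using \<open>a \<noteq> 0\<close> by (simp add: u_def sgn_div_norm divide_strict_right_mono)
  moreover have "u \<bullet> z \<le> 1 - ?\<delta>"
    using norm_cauchy_schwarz[of u z] u z(1) by simp
  moreover have "u \<bullet> (u - p) \<le> ?\<delta>"
    using norm_cauchy_schwarz[of u "u - p"] u p(2) by (simp add: dist_norm norm_minus_commute)
  moreover have "u \<bullet> u = 1" using u by (simp add: dot_square_norm)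
  ultimately show False by (simp add: inner_diff_right)
qed

lemma support_function_ge:
  assumes "bounded P" "y \<in> P"
  shows "u \<bullet> y \<le> support_function P u"
proof -
  obtain e where "\<And>y. y \<in> P \<Longrightarrow> norm y \<le> e" using assms(1) by (auto simp: bounded_iff)
  then have "u \<bullet> x \<le> norm u * e" if "x \<in> P" for x
    using norm_cauchy_schwarz[of u x] mult_left_mono[of "norm x" e "norm u"] that by fastforce
  then show ?thesis unfolding support_function_def
    by (intro cSUP_upper assms(2) bdd_aboveI2[where M="norm u * e"])
qed

lemma support_function_near_unit_ball:
  fixes P :: "'a::euclidean_space set"
  assumes "compact P" "convex P" "P \<noteq> {}" "norm u = 1" "hausdorff_dist P (cball 0 1) \<le> 1"
  shows "1 - hausdorff_dist P (cball 0 1) \<le> support_function P u"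
    and "support_function P u \<le> 1 + hausdorff_dist P (cball 0 1)"
proof -
  let ?\<delta> = "hausdorff_dist P (cball 0 1)"
  \<comment> \<open>As the distance is at most 1, the factor is nonnegative and this point lies on
    the boundary of the inscribed ball; pairing it with \<open>u\<close> gives the lower
    bound.\<close>
  have "(1 - ?\<delta>) *\<^sub>R u \<in> P"
    using cball_subset_hausdorff_dist_unit_ball[OF assms(1-3)] assms(4,5) by auto
  from support_function_ge[OF compact_imp_bounded[OF assms(1)] this, of u]
  show "1 - ?\<delta> \<le> support_function P u" using assms(4) by (simp add: dot_square_norm)
  have "u \<bullet> y \<le> 1 + ?\<delta>" if "y \<in> P" for y
    using norm_cauchy_schwarz[of u y] hausdorff_dist_unit_ball_norm_le[OF assms(1) that] assms(4)
    by simp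
  then show "support_function P u \<le> 1 + ?\<delta>"
    unfolding support_function_def using assms(3) by (intro cSUP_least)
qed

section \<open>Inclusions of balls, polarity and Hausdorff distance\<close>

lemma image_scaleR_unit_cball:
  assumes "0 \<le> r"
  shows "(\<lambda>z. r *\<^sub>R z) ` cball 0 1 = cball (0 :: 'a::real_normed_vector) r"
  using cball_scale[of r 0 1] assms by (cases "r = 0") (auto simp: image_constant_conv)

lemma cball_subset_polar:
  fixes P :: "'a::real_inner set"
  assumes "P \<subseteq> cball 0 r" "0 < r"
  shows "cball 0 (1 / r) \<subseteq> polar P"
proof
  fix z :: 'a assume z: "z \<in> cball 0 (1 / r)"
  have "z \<bullet> y \<le> 1" if "y \<in> P" for y
  proof -
    have "z \<bullet> y \<le> norm z * norm y" by (rule norm_cauchy_schwarz)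
    also have "\<dots> \<le> (1 / r) * r" using z assms that by (intro mult_mono) auto
    finally show ?thesis using assms(2) by simp
  qed
  then show "z \<in> polar P" by (simp add: polar_def)
qed

text \<open>Testing \<open>z\<close> against the point of the ball in its own direction gives
  \<open>r * norm z \<le> 1\<close>. The case \<open>z = 0\<close> fits in, since
  \<open>sgn 0 = 0\<close>.\<close>

lemma polar_subset_cball:
  fixes P :: "'a::real_inner set"
  assumes "cball 0 r \<subseteq> P" "0 < r"
  shows "polar P \<subseteq> cball 0 (1 / r)"
proof
  fix z assume z: "z \<in> polar P"
  have "r *\<^sub>R sgn z \<in> P" using assms by (intro subsetD[OF assms(1)]) (simp add: norm_sgn)
  then have "z \<bullet> (r *\<^sub>R sgn z) \<le> 1" using z by (auto simp: polar_def)
  moreover have "z \<bullet> sgn z = norm z"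
    by (cases "z = 0") (simp_all add: sgn_div_norm dot_square_norm power2_eq_square)
  ultimately show "z \<in> cball 0 (1 / r)" using assms(2) by (simp add: field_simps)
qed

text \<open>Outside the ball, the radial projection \<open>sgn z\<close> is at distance
  \<open>norm z - 1\<close>.\<close>

lemma infdist_unit_cball_le:
  fixes z :: "'a::real_normed_vector"
  assumes "norm z \<le> 1 + e" "0 \<le> e"
  shows "infdist z (cball 0 1) \<le> e"
proof (cases "norm z \<le> 1")
  case True
  then show ?thesis using assms(2) by simp
next
  case False
  have "z - sgn z = (norm z - 1) *\<^sub>R sgn z"
    using False by (cases "z = 0") (auto simp: sgn_div_norm algebra_simps)
  then have "dist z (sgn z) = norm z - 1"
    using False by (auto simp: dist_norm norm_sgn)
  then show ?thesis
    using assms(1) infdist_le[of "sgn z" "cball 0 1" z] by (cases "z = 0") (simp_all add: norm_sgn)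
qed

text \<open>The outer inclusion controls the distance from \<open>A\<close> to the ball. Conversely,
  shrinking \<open>b\<close> to \<open>r *\<^sub>R b\<close> lands in \<open>A\<close> and moves it
  by at most \<open>1 - r\<close>.\<close>

lemma hausdorff_dist_unit_ball_le:
  fixes A :: "'a::real_normed_vector set"
  assumes "cball 0 r \<subseteq> A" "A \<subseteq> cball 0 (1 + e)" "0 \<le> r" "r \<le> 1" "1 - r \<le> e"
  shows "hausdorff_dist A (cball 0 1) \<le> e"
proof -
  have "A \<noteq> {}" using assms(1,3) by auto
  moreover have "infdist a (cball 0 1) \<le> e" if "a \<in> A" for a
    using assms that by (intro infdist_unit_cball_le) auto
  moreover have "infdist b A \<le> e" if "b \<in> cball 0 1" for b
  proof -
    have b: "norm b \<le> 1" using that by simp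
    have "r *\<^sub>R b \<in> A"
      using assms b by (intro subsetD[OF assms(1)]) (simp add: mult_left_le)
    moreover have "b - r *\<^sub>R b = (1 - r) *\<^sub>R b" by (simp add: algebra_simps)
    then have "dist b (r *\<^sub>R b) = (1 - r) * norm b"
      using assms(4) by (simp add: dist_norm)
    moreover have "(1 - r) * norm b \<le> 1 - r" using b assms(4) by (intro mult_left_le) auto
    ultimately show ?thesis
      using infdist_le[of "r *\<^sub>R b" A b] assms(5) by linarith
  qed
  ultimately show ?thesis
    unfolding hausdorff_dist_def by (auto intro!: cSUP_least simp del: mem_cball mem_cball_0)
qed

section \<open>Tensor powers, their norms and a scalar power estimate\<close>

lemma polynomial_tensor_power:
  fixes I :: "'n::finite list"
  assumes "m \<le> t"
  shows "polynomial_of_degree_le t (\<lambda>x :: real ^ 'n. tensor_power m x I)"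
proof -
  \<comment> \<open>Each component is a single monomial: the exponent of \<open>x $ i\<close> counts
    the positions of \<open>I\<close> below \<open>m\<close> holding \<open>i\<close>. Grouping
    positions by their entry shows that the degree is \<open>m\<close>.\<close>
  define \<alpha> where "\<alpha> i = card {k\<in>{..<m}. I ! k = i}" for i
  have "sum \<alpha> UNIV = m"
    using sum.group[of "{..<m}" UNIV "(!) I" "\<lambda>_. 1::nat"] by (simp add: \<alpha>_def)
  then have mem: "\<alpha> \<in> {\<beta>. sum \<beta> UNIV \<le> t}" using assms by simp
  have "tensor_power m x I = (\<Prod>i\<in>UNIV. (x $ i) ^ \<alpha> i)" for x :: "real ^ 'n"
  proof -
    have "(\<Prod>i\<in>UNIV. (x $ i) ^ \<alpha> i) = (\<Prod>i\<in>UNIV. \<Prod>k\<in>{k\<in>{..<m}. I ! k = i}. x $ (I ! k))"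
      unfolding \<alpha>_def by (auto intro!: prod.cong)
    also have "\<dots> = (\<Prod>k<m. x $ (I ! k))" by (rule prod.group) auto
    finally show ?thesis by (simp add: tensor_power_def)
  qed
  then have "tensor_power m x I
      = (\<Sum>\<beta> | sum \<beta> UNIV \<le> t. of_bool (\<beta> = \<alpha>) * (\<Prod>i\<in>UNIV. (x $ i) ^ \<beta> i))" for x :: "real ^ 'n"
    using mem sum.delta[OF finite_multi_indices[of t], of \<alpha> "\<lambda>\<beta>. \<Prod>i\<in>UNIV. (x $ i) ^ \<beta> i"]
    by (simp add: of_bool_def if_distrib[of "\<lambda>c. c * _"] cong: if_cong)
  then show ?thesis
    unfolding polynomial_of_degree_le_def by (intro exI[of _ "\<lambda>\<beta>. of_bool (\<beta> = \<alpha>)"]) blast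
qed

lemma tensor_power_scaleR: "tensor_power m (c *\<^sub>R x) I = c ^ m * tensor_power m x I"
  by (simp add: tensor_power_def prod.distrib)

lemma hs_norm_eq_L2_set: "hs_norm m T = L2_set T {I. length I = m}"
  by (simp add: hs_norm_def L2_set_def)

lemma hs_norm_scale: "hs_norm m (\<lambda>I. c * T I) = \<bar>c\<bar> * hs_norm m T"
  by (simp add: hs_norm_def power_mult_distrib sum_distrib_left[symmetric] real_sqrt_mult)

lemma hs_norm_sum_le: "hs_norm m (\<lambda>I. \<Sum>a\<in>A. T a I) \<le> (\<Sum>a\<in>A. hs_norm m (T a))"
proof (induction A rule: infinite_finite_induct)
  case (insert a A)
  have "hs_norm m (\<lambda>I. T a I + (\<Sum>a\<in>A. T a I)) \<le> hs_norm m (T a) + hs_norm m (\<lambda>I. \<Sum>a\<in>A. T a I)"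
    unfolding hs_norm_eq_L2_set by (rule L2_set_triangle_ineq)
  then show ?case using insert by simp
qed (auto simp: hs_norm_def)

text \<open>Above 1 the bound is monotonicity of powers. Below 1 the deviation is at most
  \<open>1 - 1 / q ^ m\<close>, and this is at most \<open>q ^ m - 1\<close> because
  \<open>a + 1 / a\<close> is at least 2 for positive \<open>a\<close>.\<close>

lemma abs_power_minus_one_le:
  fixes g q :: real
  assumes "1 \<le> q" "1 / q \<le> g" "g \<le> q"
  shows "\<bar>g ^ m - 1\<bar> \<le> q ^ m - 1"
proof -
  have "0 \<le> g" using assms by (smt (verit) divide_nonneg_nonneg)
  then have "g ^ m \<le> q ^ m" using assms by (intro power_mono)
  moreover have "1 / q ^ m \<le> g ^ m"
    using assms power_mono[of "1 / q" g m] by (simp add: power_one_over)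
  moreover have "2 \<le> q ^ m + 1 / q ^ m"
  proof -
    have "2 \<le> a + 1 / a" if "0 < a" for a :: real
      using that sum_squares_bound[of a 1] by (simp add: field_simps power2_eq_square)
    then show ?thesis using assms(1) by simp
  qed
  ultimately show ?thesis by linarith
qed

section \<open>The moment difference and its Hilbert-Schmidt norm\<close>

lemma vertex_moment_minus_sphere_moment:
  fixes X :: "(real ^ 'n) set"
  assumes "spherical_design t X" "m \<le> t"
  shows "vertex_moment m X P I - sphere_moment m I
    = (\<Sum>x\<in>X. ((1 / support_function P x) ^ m - 1) / card X * tensor_power m x I)"
proof -
  have "sphere_moment m I = (\<Sum>x\<in>X. tensor_power m x I) / card X"
    using assms polynomial_tensor_power[OF assms(2), of I]
    unfolding spherical_design_def sphere_moment_def by metis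
  then show ?thesis
    by (simp add: vertex_moment_def dual_vertex_def tensor_power_scaleR inverse_eq_divide
        sum_subtractf sum_divide_distrib left_diff_distrib diff_divide_distrib)
qed

lemma hs_norm_moment_diff_le:
  fixes X :: "(real ^ 'n) set"
  assumes X: "spherical_design t X" and "m \<le> t" and "1 \<le> q"
    and h: "\<And>x. norm x = 1 \<Longrightarrow> 1 / q \<le> 1 / support_function P x \<and> 1 / support_function P x \<le> q"
  shows "hs_norm m (\<lambda>I. vertex_moment m X P I - sphere_moment m I) \<le> q ^ m - 1"
proof -
  let ?c = "\<lambda>x. (1 / support_function P x) ^ m - 1"
  have X': "finite X" "X \<noteq> {}" "X \<subseteq> sphere 0 1"
    using X by (auto simp: spherical_design_def)
  have "hs_norm m (\<lambda>I. vertex_moment m X P I - sphere_moment m I)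
      \<le> (\<Sum>x\<in>X. hs_norm m (\<lambda>I. ?c x / card X * tensor_power m x I))"
    unfolding vertex_moment_minus_sphere_moment[OF X \<open>m \<le> t\<close>] by (rule hs_norm_sum_le)
  \<comment> \<open>Design points are unit vectors, so their tensor powers have norm 1 and only the
    scalar factors remain.\<close>
  also have "\<dots> = (\<Sum>x\<in>X. \<bar>?c x\<bar>) / card X"
    unfolding hs_norm_scale hs_norm_tensor_power sum_divide_distrib
    using X' by (intro sum.cong) auto
  also have "\<dots> \<le> (\<Sum>x\<in>X. q ^ m - 1) / card X"
    using X' h \<open>1 \<le> q\<close> by (intro divide_right_mono sum_mono abs_power_minus_one_le) auto
  also have "\<dots> = q ^ m - 1" using X' by simp
  finally show ?thesis .
qed

theorem theorem3p3:
  fixes X P :: "(real ^ 'n) set" and t :: nat and \<delta> :: real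
  assumes "CARD('n) \<ge> 2" and "t \<ge> 2"
    and "spherical_design t X"
    and "is_minkowski_polytope X P" and "steiner_point P = 0"
    and "\<delta> = hausdorff_dist P (cball 0 1)" and "\<delta> < 1"
  shows "(\<forall>m\<le>t.
           hs_norm m (\<lambda>I. vertex_moment m X P I - sphere_moment m I) \<le> (1 - \<delta>) powi (- int m) - 1 \<and>
           (1 - \<delta>) powi (- int m) - 1 \<le> exp (real m * \<delta> / (1 - \<delta>)) - 1) \<and>
         (\<lambda>z. (1 / (1 + \<delta>)) *\<^sub>R z) ` cball 0 1 \<subseteq> polar P \<and>
         polar P \<subseteq> (\<lambda>z. (1 / (1 - \<delta>)) *\<^sub>R z) ` cball 0 1 \<and>
         hausdorff_dist (polar P) (cball 0 1) \<le> \<delta> / (1 - \<delta>)"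
proof -
  let ?q = "1 / (1 - \<delta>)"
  have P: "compact P" "convex P" "P \<noteq> {}"
    using assms(4) polytope_imp_compact polytope_imp_convex
    by (auto simp: is_minkowski_polytope_def)
  have \<delta>0: "0 \<le> \<delta>"
    using hausdorff_dist_nonneg[of P "cball 0 1"] P assms(6) by (simp add: compact_imp_bounded)
  have q: "1 \<le> ?q" using \<delta>0 assms(7) by simp
  have powi: "(1 - \<delta>) powi (- int m) = ?q ^ m" for m
    by (simp add: power_int_minus power_one_over inverse_eq_divide)
  have "1 / ?q \<le> 1 / support_function P x \<and> 1 / support_function P x \<le> ?q" if "norm x = 1" for x
  proof -
    have h: "1 - \<delta> \<le> support_function P x" "support_function P x \<le> 1 + \<delta>"
      using support_function_near_unit_ball[OF P that] assms(6,7) by auto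
    \<comment> \<open>The product on the right is 1 - \<delta>*\<delta>, so the reciprocal of the
      support function is at least 1 - \<delta>, which is \<open>1 / ?q\<close>.\<close>
    have "(1 - \<delta>) * support_function P x \<le> (1 - \<delta>) * (1 + \<delta>)"
      using h assms(7) by (intro mult_left_mono) auto
    also have "\<dots> \<le> 1" by (simp add: algebra_simps)
    finally show ?thesis using h assms(7) by (simp add: field_simps)
  qed
  then have moment: "hs_norm m (\<lambda>I. vertex_moment m X P I - sphere_moment m I) \<le> ?q ^ m - 1"
    if "m \<le> t" for m
    using hs_norm_moment_diff_le[OF assms(3) that q] by blast
  have exp: "?q ^ m \<le> exp (real m * \<delta> / (1 - \<delta>))" for m
  proof -
    \<comment> \<open>In this form the inequality 1 + x \<le> \<open>exp x\<close> applies, and the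
      \<open>m\<close>-th power follows.\<close>
    have "?q = 1 + \<delta> / (1 - \<delta>)" using assms(7) by (simp add: field_simps)
    also have "\<dots> \<le> exp (\<delta> / (1 - \<delta>))" by (rule exp_ge_add_one_self)
    finally have "?q ^ m \<le> exp (\<delta> / (1 - \<delta>)) ^ m"
      using assms(7) by (intro power_mono) auto
    then show ?thesis by (simp add: exp_of_nat_mult[symmetric])
  qed
  have outer: "P \<subseteq> cball 0 (1 + \<delta>)" and inner: "cball 0 (1 - \<delta>) \<subseteq> P"
    using hausdorff_dist_unit_ball_norm_le[OF P(1)] cball_subset_hausdorff_dist_unit_ball[OF P]
      assms(6) by auto
  have polar: "cball 0 (1 / (1 + \<delta>)) \<subseteq> polar P" "polar P \<subseteq> cball 0 ?q"
    using cball_subset_polar[OF outer] polar_subset_cball[OF inner] \<delta>0 assms(7) by auto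
  have "hausdorff_dist (polar P) (cball 0 1) \<le> \<delta> / (1 - \<delta>)"
  \<comment> \<open>The outer radius \<open>?q\<close> exceeds 1 by exactly \<delta> / (1 -
    \<delta>), while the inner radius falls short of 1 by only \<delta> / (1 + \<delta>); the outer
    gap therefore gives the bound.\<close>
  proof (rule hausdorff_dist_unit_ball_le[OF polar(1)])
    show "polar P \<subseteq> cball 0 (1 + \<delta> / (1 - \<delta>))"
      using polar(2) assms(7) by (simp add: field_simps)
    have "1 - 1 / (1 + \<delta>) = \<delta> / (1 + \<delta>)" using \<delta>0 by (simp add: field_simps)
    also have "\<dots> \<le> \<delta> / (1 - \<delta>)" using \<delta>0 assms(7) by (intro divide_left_mono) auto
    finally show "1 - 1 / (1 + \<delta>) \<le> \<delta> / (1 - \<delta>)" .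
  qed (use \<delta>0 in auto)
  with moment exp polar show ?thesis
    using \<delta>0 assms(7) by (simp add: powi image_scaleR_unit_cball)
qed

end
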